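(* If $p$ is a prime number, then every nontrivially unstable circulant graph $\mathrm{Cay}(\mathbb{Z}_{2p}, S)$ of order $2p$ has Wilson type (C.4); that is, there exists $m \in \mathbb{Z}_{2p}^\times$ such that $p + mS = S$.
   Context: All graphs are finite, simple and undirected. For $S \subseteq \mathbb{Z}_n$ with $-S = S$, $0 \notin S$, the circulant graph $\mathrm{Cay}(\mathbb{Z}_n,S)$ has vertex set $\mathbb{Z}_n$ with $v \sim w$ iff $w - v \in S$; $mS = \{ms : s\in S\}$. The canonical bipartite double cover $BX$ of a graph $X$ has vertex set $V(X)\times\{0,1\}$, with $(v,0)\sim(w,1)$ iff $v\sim w$ in $X$. $\mathrm{Aut}\,X\times S_2$ embeds in $\mathrm{Aut}\,BX$ via $(\varphi,\sigma)(v,i)=(\varphi(v),\sigma(i))$; $X$ is unstable if $\mathrm{Aut}\,BX\neq \mathrm{Aut}\,X\times S_2$. $X$ is twin-free if no two distinct vertices have exactly the same set of neighbors. $X$ is nontrivially unstable if it is connected, nonbipartite, twin-free, and unstable. *)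

theory Defs
  imports "HOL-Number_Theory.Residues" "HOL-Algebra.Bij" "Graph_Theory.Graph_Theory"
begin

text \<open>
  Graphs are those of the locale \<^locale>\<open>pair_graph\<close>: finite, loopless, and with every
  undirected edge stored as a pair of opposite arcs. The ring of integers modulo \<open>n\<close> is
  \<^term>\<open>residue_ring n\<close>, whose elements are the representatives in \<open>{0..n - 1}\<close>.
\<close>

definition circulant_graph :: "int \<Rightarrow> int set \<Rightarrow> int pair_pre_digraph" where
  "circulant_graph n S =
     \<lparr> pverts = carrier (residue_ring n),
       parcs = {(v, w). v \<in> carrier (residue_ring n) \<and> w \<in> carrier (residue_ring n) \<and>
                        w \<ominus>\<^bsub>residue_ring n\<^esub> v \<in> S} \<rparr>"

definition bipartite_double_cover :: "'a pair_pre_digraph \<Rightarrow> ('a \<times> nat) pair_pre_digraph" where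
  "bipartite_double_cover X =
     \<lparr> pverts = pverts X \<times> {0, 1},
       parcs = {((v, 0), (w, 1)) | v w. (v, w) \<in> parcs X} \<union>
               {((w, 1), (v, 0)) | v w. (v, w) \<in> parcs X} \<rparr>"

text \<open>
  Permutations of a set \<open>V\<close> are elements of \<^term>\<open>Bij V\<close>, hence \<^term>\<open>undefined\<close> outside \<open>V\<close>,
  so that automorphisms are equal as soon as they agree on all vertices.
\<close>

definition automorphisms :: "'a pair_pre_digraph \<Rightarrow> ('a \<Rightarrow> 'a) set" where
  "automorphisms X =
     {f \<in> Bij (pverts X). \<forall>u \<in> pverts X. \<forall>v \<in> pverts X.
        (f u, f v) \<in> parcs X \<longleftrightarrow> (u, v) \<in> parcs X}"

text \<open>The image of \<open>Aut X \<times> S\<^sub>2\<close> under its embedding in \<open>Aut BX\<close>.\<close>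

definition expected_automorphisms :: "'a pair_pre_digraph \<Rightarrow> ('a \<times> nat \<Rightarrow> 'a \<times> nat) set" where
  "expected_automorphisms X =
     {restrict (map_prod \<phi> \<sigma>) (pverts X \<times> {0, 1}) | \<phi> \<sigma>.
        \<phi> \<in> automorphisms X \<and> \<sigma> \<in> Bij {0, 1}}"

definition unstable :: "'a pair_pre_digraph \<Rightarrow> bool" where
  "unstable X \<longleftrightarrow> automorphisms (bipartite_double_cover X) \<noteq> expected_automorphisms X"

definition bipartite :: "'a pair_pre_digraph \<Rightarrow> bool" where
  "bipartite X \<longleftrightarrow> (\<exists>A B. A \<union> B = pverts X \<and> A \<inter> B = {} \<and>
     (\<forall>(u, v) \<in> parcs X. u \<in> A \<and> v \<in> B \<or> u \<in> B \<and> v \<in> A))"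

definition twin_free :: "'a pair_pre_digraph \<Rightarrow> bool" where
  "twin_free X \<longleftrightarrow> (\<forall>u \<in> pverts X. \<forall>v \<in> pverts X.
     u \<noteq> v \<longrightarrow> parcs X `` {u} \<noteq> parcs X `` {v})"

definition nontrivially_unstable :: "'a pair_pre_digraph \<Rightarrow> bool" where
  "nontrivially_unstable X \<longleftrightarrow>
     Digraph_Component.connected (with_proj X) \<and> \<not> bipartite X \<and> twin_free X \<and> unstable X"

lemma pair_graph_circulant_graph:
  assumes "n > 1" and "S \<subseteq> carrier (residue_ring n)"
    and sym: "(\<lambda>s. \<ominus>\<^bsub>residue_ring n\<^esub> s) ` S = S" and zero: "\<zero>\<^bsub>residue_ring n\<^esub> \<notin> S"
  shows "pair_graph (circulant_graph n S)"
proof -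
  interpret residues n "residue_ring n"
    using assms(1) by unfold_locales auto
  have neg: "v \<ominus>\<^bsub>residue_ring n\<^esub> w \<in> S"
    if v: "v \<in> carrier (residue_ring n)" and w: "w \<in> carrier (residue_ring n)"
      and d: "w \<ominus>\<^bsub>residue_ring n\<^esub> v \<in> S" for v w
  proof -
    have "\<ominus>\<^bsub>residue_ring n\<^esub> (w \<ominus>\<^bsub>residue_ring n\<^esub> v) \<in> S"
      using sym d by blast
    moreover have "\<ominus>\<^bsub>residue_ring n\<^esub> (w \<ominus>\<^bsub>residue_ring n\<^esub> v) = v \<ominus>\<^bsub>residue_ring n\<^esub> w"
      using v w by (simp add: a_minus_def minus_add a_comm)
    ultimately show ?thesis by simp
  qed
  have irr: "v \<ominus>\<^bsub>residue_ring n\<^esub> v \<notin> S" if "v \<in> carrier (residue_ring n)" for v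
    using that zero by (simp add: a_minus_def r_neg)
  have "finite (carrier (residue_ring n) \<times> carrier (residue_ring n))"
    by simp
  then have "finite (parcs (circulant_graph n S))"
    by (rule rev_finite_subset) (auto simp: circulant_graph_def)
  then show ?thesis
    using neg irr
    by unfold_locales (force simp: circulant_graph_def symmetric_def sym_def)+
qed

lemma pair_graph_bipartite_double_cover:
  assumes "pair_graph X"
  shows "pair_graph (bipartite_double_cover X)"
proof -
  interpret pair_graph X by fact
  have "parcs (bipartite_double_cover X) \<subseteq> (pverts X \<times> {0, 1}) \<times> (pverts X \<times> {0, 1})"
    by (auto simp: bipartite_double_cover_def dest: in_arcsD1 in_arcsD2)
  moreover from this have "finite (parcs (bipartite_double_cover X))"
    by (rule finite_subset) (simp add: pair_finite_verts)
  ultimately show ?thesis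
    using pair_finite_verts
    by unfold_locales (force simp: bipartite_double_cover_def symmetric_def sym_def)+
qed

lemma expected_automorphisms_subset:
  assumes "pair_graph X"
  shows "expected_automorphisms X \<subseteq> automorphisms (bipartite_double_cover X)"
proof
  interpret pair_graph X by fact
  fix f assume "f \<in> expected_automorphisms X"
  then obtain \<phi> \<sigma> where f: "f = restrict (map_prod \<phi> \<sigma>) (pverts X \<times> {0, 1})"
    and \<phi>: "\<phi> \<in> automorphisms X" and \<sigma>: "\<sigma> \<in> Bij {0, 1}"
    unfolding expected_automorphisms_def by blast
  have b1: "bij_betw \<phi> (pverts X) (pverts X)"
    and a1: "\<And>u v. u \<in> pverts X \<Longrightarrow> v \<in> pverts X \<Longrightarrow> (\<phi> u, \<phi> v) \<in> parcs X \<longleftrightarrow> (u, v) \<in> parcs X"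
    using \<phi> by (auto simp: automorphisms_def Bij_def)
  have b2: "bij_betw \<sigma> {0, 1} {0, 1}" using \<sigma> by (simp add: Bij_def)
  have "bij_betw f (pverts X \<times> {0, 1}) (pverts X \<times> {0, 1})"
    unfolding f using bij_betw_map_prod[OF b1 b2] by (simp add: bij_betw_restrict_eq)
  then have fB: "f \<in> Bij (pverts X \<times> {0, 1})"
    by (simp add: Bij_def f)
  have sy: "(u, v) \<in> parcs X \<longleftrightarrow> (v, u) \<in> parcs X" for u v
    using pair_sym_arcs by (auto simp: symmetric_def dest: symD)
  have arc: "((v, i), (w, j)) \<in> parcs (bipartite_double_cover X) \<longleftrightarrow>
      (v, w) \<in> parcs X \<and> (i = 0 \<and> j = 1 \<or> i = 1 \<and> j = 0)" for v w i j
    using sy by (auto simp: bipartite_double_cover_def)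
  have "\<sigma> 0 \<in> {0, 1}" "\<sigma> 1 \<in> {0, 1}" "\<sigma> 0 \<noteq> \<sigma> 1"
    using bij_betw_apply[OF b2] inj_onD[OF bij_betw_imp_inj_on[OF b2], of 0 1] by force+
  then have s: "(\<sigma> i = 0 \<and> \<sigma> j = 1 \<or> \<sigma> i = 1 \<and> \<sigma> j = 0) \<longleftrightarrow> (i = 0 \<and> j = 1 \<or> i = 1 \<and> j = 0)"
    if "i \<in> {0, 1}" "j \<in> {0, 1}" for i j
    using that by auto
  have "(f x, f y) \<in> parcs (bipartite_double_cover X) \<longleftrightarrow> (x, y) \<in> parcs (bipartite_double_cover X)"
    if x: "x \<in> pverts X \<times> {0, 1}" and y: "y \<in> pverts X \<times> {0, 1}" for x y
  proof -
    obtain v i w j where xy: "x = (v, i)" "y = (w, j)" by (metis surj_pair)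
    then have m: "v \<in> pverts X" "w \<in> pverts X" "i \<in> {0, 1}" "j \<in> {0, 1}"
      using x y by blast+
    have "f x = (\<phi> v, \<sigma> i)" "f y = (\<phi> w, \<sigma> j)"
      using x y by (simp_all only: f xy restrict_apply' map_prod_simp)
    then show ?thesis
      by (simp only: xy arc a1[OF m(1,2)] s[OF m(3,4)])
  qed
  moreover have "pverts (bipartite_double_cover X) = pverts X \<times> {0, 1}"
    by (simp add: bipartite_double_cover_def)
  ultimately show "f \<in> automorphisms (bipartite_double_cover X)"
    using fB unfolding automorphisms_def by (simp only: mem_Collect_eq) blast
qed

end

theory Submission
  imports Defs "HOL-Computational_Algebra.Polynomial"
begin

text \<open>
  An instability of \<open>Cay(Z\<^sub>2\<^sub>p, S)\<close> is a pair \<open>(\<alpha>, \<beta>)\<close> of distinct permutations with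
  \<open>\<beta> y - \<alpha> x \<in> S \<longleftrightarrow> y - x \<in> S\<close>. Call a function \<open>c\<close> on \<open>Z\<^sub>2\<^sub>p\<close> crossing if
  \<open>c (\<beta> y - \<alpha> x) = c (y - x)\<close>, and parallel if \<open>c (\<alpha> y - \<alpha> x) = c (y - x)\<close>, for all such pairs.
  Cyclic convolution grades these two spaces: crossing times crossing is parallel, and parallel times
  crossing is crossing. Since the \<open>q\<close>-th convolution power of the indicator of a set \<open>T\<close> is the
  indicator of \<open>q T\<close> modulo \<open>q\<close> for primes \<open>q\<close> coprime to \<open>2p\<close>, the partition of \<open>Z\<^sub>2\<^sub>p\<close> into minimal crossing sets is
  permuted by the units, as for Schur rings.

  Let \<open>p\<close> be odd. The class of \<open>0\<close> is a union of unit orbits. It is not \<open>{0}\<close> by instability, it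
  contains no element outside \<open>{0, p}\<close> by connectedness, nonbipartiteness and a convolution computation,
  so it is \<open>{0, p}\<close>. Then some class contains both an even \<open>x\<close> prime to
  \<open>p\<close> and \<open>d x + p\<close> for a unit \<open>d\<close>, and multiplication by \<open>d\<close> followed by translation by \<open>p\<close> preserves every class, in particular \<open>S\<close>.
\<close>

section \<open>Periodic functions and cyclic convolution\<close>

text \<open>Functions on Z_n are encoded as n-periodic functions on all integers, so that
  differences and multiples of arguments need no reduction.\<close>

definition periodic :: "int \<Rightarrow> (int \<Rightarrow> 'a) \<Rightarrow> bool" where
  "periodic n c \<longleftrightarrow> (\<forall>x y. [x = y] (mod n) \<longrightarrow> c x = c y)"

lemma periodicD: "periodic n c \<Longrightarrow> [x = y] (mod n) \<Longrightarrow> c x = c y"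
  by (simp add: periodic_def)

lemma periodic_mod: "periodic n c \<Longrightarrow> c (x mod n) = c x"
  by (erule periodicD) (simp add: cong_def)

lemma periodic_comp: "periodic n c \<Longrightarrow> periodic n (\<lambda>z. h (c z))"
  unfolding periodic_def by (intro allI impI arg_cong[of _ _ h]) blast

lemma periodic_affine:
  assumes "periodic n c" shows "periodic n (\<lambda>x. c (m * x + a))"
  unfolding periodic_def
  by (intro allI impI periodicD[OF assms] cong_add cong_mult cong_refl)

lemma periodic_dvd: "k dvd n \<Longrightarrow> periodic n (\<lambda>z. k dvd z)"
  unfolding periodic_def by (metis cong_dvd_iff cong_dvd_modulus)

lemma bij_betw_affine_mod:
  fixes n :: int
  assumes n: "0 < n" and "coprime m n"
  shows "bij_betw (\<lambda>x. (m * x + a) mod n) {0..<n} {0..<n}"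
proof -
  have inj: "inj_on (\<lambda>x. (m * x + a) mod n) {0..<n}"
  proof (rule inj_onI)
    fix x y assume xy: "x \<in> {0..<n}" "y \<in> {0..<n}" "(m * x + a) mod n = (m * y + a) mod n"
    then have "[m * x + a = m * y + a] (mod n)" by (simp add: cong_def)
    then have "[x = y] (mod n)"
      using assms(2) by (simp add: cong_add_rcancel cong_mult_lcancel)
    then show "x = y" using xy by (simp add: cong_def)
  qed
  have sub: "(\<lambda>x. (m * x + a) mod n) ` {0..<n} \<subseteq> {0..<n}" using n by auto
  show ?thesis
    using inj endo_inj_surj[OF _ sub inj] by (simp add: bij_betw_def)
qed

lemma sum_periodic_affine:
  fixes n :: int
  assumes "0 < n" "coprime m n" and c: "periodic n c"
  shows "(\<Sum>x\<in>{0..<n}. c (m * x + a)) = (\<Sum>x\<in>{0..<n}. c x)"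
proof -
  have "(\<Sum>x\<in>{0..<n}. c (m * x + a)) = (\<Sum>x\<in>{0..<n}. c ((m * x + a) mod n))"
    by (simp add: periodic_mod[OF c])
  also have "\<dots> = (\<Sum>x\<in>{0..<n}. c x)"
    by (rule sum.reindex_bij_betw[OF bij_betw_affine_mod]) fact+
  finally show ?thesis .
qed

definition conv :: "int \<Rightarrow> (int \<Rightarrow> int) \<Rightarrow> (int \<Rightarrow> int) \<Rightarrow> int \<Rightarrow> int" where
  "conv n c d z = (\<Sum>x\<in>{0..<n}. c x * d (z - x))"

lemma periodic_conv:
  assumes "periodic n d" shows "periodic n (conv n c d)"
  unfolding periodic_def conv_def
  by (intro allI impI sum.cong refl arg_cong2[of _ _ _ _ "(*)"] periodicD[OF assms] cong_diff cong_refl)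

lemma conv_commute:
  assumes n: "0 < n" and c: "periodic n c" and d: "periodic n d"
  shows "conv n c d z = conv n d c z"
proof -
  have "periodic n (\<lambda>x. c x * d (z - x))"
    using periodic_affine[OF d, of "- 1" z] c unfolding periodic_def by simp
  from sum_periodic_affine[OF n _ this, of "- 1" z] show ?thesis
    by (simp add: conv_def mult.commute)
qed

text \<open>Shifting the summation variable by x gives a weighted count of two-step walks from x
  over w to y. In this form a permutation can be substituted for w.\<close>

lemma conv_diff_arg:
  assumes n: "0 < n" and c: "periodic n c" and d: "periodic n d"
  shows "conv n c d (y - x) = (\<Sum>w\<in>{0..<n}. c (w - x) * d (y - w))"
proof -
  have "periodic n (\<lambda>w. c (w - x) * d (y - w))"
    using periodic_affine[OF d, of "- 1" y] periodic_affine[OF c, of 1 "- x"]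
    unfolding periodic_def by simp
  from sum_periodic_affine[OF n _ this, of 1 x] show ?thesis
    by (simp add: conv_def algebra_simps)
qed

lemma conv_linear:
  "conv n (\<lambda>x. f x + g x) h z = conv n f h z + conv n g h z"
  "conv n (\<lambda>x. f x - g x) h z = conv n f h z - conv n g h z"
  "conv n h (\<lambda>x. f x + g x) z = conv n h f z + conv n h g z"
  "conv n h (\<lambda>x. f x - g x) z = conv n h f z - conv n h g z"
  "conv n (\<lambda>x. k * f x) h z = k * conv n f h z"
  "conv n h (\<lambda>x. k * f x) z = k * conv n h f z"
  by (simp_all add: conv_def algebra_simps sum.distrib sum_subtractf sum_distrib_left)

lemma conv_delta:
  assumes "0 < n"
  shows "conv n (\<lambda>x. of_bool (n dvd x)) c z = c z"
proof -
  have "conv n (\<lambda>x. of_bool (n dvd x)) c z = (\<Sum>x\<in>{0..<n}. if x = 0 then c z else 0)"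
    unfolding conv_def by (intro sum.cong refl) (auto dest: zdvd_imp_le)
  then show ?thesis using assms by simp
qed

section \<open>The Frobenius congruence in the group ring of a cyclic group\<close>

text \<open>For positive n, the coefficient function of the image of f in Z[X] / (X^n - 1), the
  group ring of Z_n. Powers can thus be computed among integer polynomials.\<close>

definition wrap :: "int \<Rightarrow> int poly \<Rightarrow> int \<Rightarrow> int" where
  "wrap n f z = (\<Sum>j\<le>degree f. if [int j = z] (mod n) then coeff f j else 0)"

lemma wrap_eq:
  assumes "degree f \<le> N"
  shows "wrap n f z = (\<Sum>j\<le>N. if [int j = z] (mod n) then coeff f j else 0)"
  unfolding wrap_def
  by (rule sum.mono_neutral_left) (use assms in \<open>auto simp: coeff_eq_0\<close>)

lemma periodic_wrap: "periodic n (wrap n f)"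
  unfolding periodic_def wrap_def by (auto intro!: sum.cong simp: cong_def)

lemma wrap_0: "wrap n 0 z = 0"
  by (simp add: wrap_def cong: if_cong)

lemma wrap_add: "wrap n (f + g) z = wrap n f z + wrap n g z"
proof -
  define N where "N = max (degree f) (degree g)"
  have "degree f \<le> N" "degree g \<le> N" "degree (f + g) \<le> N"
    by (auto simp: N_def degree_add_le)
  then show ?thesis
    by (simp add: wrap_eq[of _ N] flip: sum.distrib) (auto intro!: sum.cong)
qed

lemma wrap_smult: "wrap n (smult a f) z = a * wrap n f z"
proof -
  have "degree (smult a f) \<le> degree f" by (rule degree_smult_le)
  then show ?thesis
    by (simp add: wrap_eq[of _ "degree f"] sum_distrib_left) (auto intro!: sum.cong)
qed

lemma wrap_pCons: "wrap n (pCons a f) z = of_bool (n dvd z) * a + wrap n f (z - 1)"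
proof -
  have "wrap n (pCons a f) z =
      (\<Sum>j\<le>Suc (degree f). if [int j = z] (mod n) then coeff (pCons a f) j else 0)"
    by (rule wrap_eq) (simp add: degree_pCons_le)
  also have "\<dots> = (if [0 = z] (mod n) then a else 0) +
      (\<Sum>j\<le>degree f. if [int j + 1 = z] (mod n) then coeff f j else 0)"
    by (subst sum.atMost_Suc_shift) (simp add: add.commute cong: if_cong)
  also have "[0 = z] (mod n) \<longleftrightarrow> n dvd z"
    by (metis cong_0_iff cong_sym_eq)
  also have "(\<lambda>j. [int j + 1 = z] (mod n)) = (\<lambda>j. [int j = z - 1] (mod n))"
    by (simp add: cong_iff_dvd_diff algebra_simps)
  finally show ?thesis by (simp add: wrap_def)
qed

lemma wrap_monom: "wrap n (monom a k) z = of_bool ([int k = z] (mod n)) * a"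
proof (induction k arbitrary: z)
  case 0
  have "[0 = z] (mod n) \<longleftrightarrow> n dvd z" by (metis cong_0_iff cong_sym_eq)
  then show ?case by (simp add: monom_0 wrap_pCons wrap_0)
next
  case (Suc k)
  have "[int k = z - 1] (mod n) \<longleftrightarrow> [int (Suc k) = z] (mod n)"
    by (simp add: cong_iff_dvd_diff algebra_simps)
  then show ?case by (simp add: monom_Suc wrap_pCons Suc.IH)
qed

lemma wrap_sum: "wrap n (\<Sum>i\<in>A. f i) z = (\<Sum>i\<in>A. wrap n (f i) z)"
  by (induction A rule: infinite_finite_induct) (simp_all add: wrap_0 wrap_add)

text \<open>Induction along the Horner form of f: the constant coefficient acts as a multiple of the
  convolution identity, and a factor X shifts the argument by one.\<close>

lemma wrap_mult:
  assumes n: "0 < n"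
  shows "wrap n (f * g) z = conv n (wrap n f) (wrap n g) z"
proof (induction f arbitrary: z)
  case 0
  show ?case by (simp add: wrap_0 conv_def)
next
  case (pCons a f)
  have "wrap n (pCons a f * g) z = a * wrap n g z + wrap n (f * g) (z - 1)"
    by (simp add: mult_pCons_left wrap_add wrap_smult wrap_pCons)
  also have "wrap n (f * g) (z - 1) = conv n (wrap n f) (wrap n g) (z - 1)"
    by (rule pCons.IH)
  also have "\<dots> = (\<Sum>x\<in>{0..<n}. wrap n f (x - 1) * wrap n g (z - x))"
    by (rule conv_diff_arg[OF n periodic_wrap periodic_wrap])
  also have "a * wrap n g z = conv n (\<lambda>x. of_bool (n dvd x)) (\<lambda>x. a * wrap n g x) z"
    using n by (simp add: conv_delta)
  finally show ?case
    by (simp add: conv_def wrap_pCons algebra_simps sum.distrib)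
qed

lemma add_power_prime:
  fixes a b :: "'a :: comm_ring_1"
  assumes q: "prime q"
  shows "\<exists>r. (a + b) ^ q = a ^ q + b ^ q + of_nat q * r"
proof -
  have q1: "q \<ge> 1" using prime_ge_1_nat[OF q] .
  have "of_nat (q choose k) * a ^ k * b ^ (q - k) =
      of_nat q * (of_nat ((q choose k) div q) * a ^ k * b ^ (q - k))" if "k \<in> {1..<q}" for k
  proof -
    have "q dvd (q choose k)" using that by (intro dvd_choose_prime q) auto
    then have "of_nat (q choose k) = (of_nat q * of_nat ((q choose k) div q) :: 'a)"
      by (metis dvd_mult_div_cancel of_nat_mult)
    then show ?thesis by (simp add: mult_ac)
  qed
  then have "(\<Sum>k\<in>{1..<q}. of_nat (q choose k) * a ^ k * b ^ (q - k)) =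
      of_nat q * (\<Sum>k\<in>{1..<q}. of_nat ((q choose k) div q) * a ^ k * b ^ (q - k))"
    by (simp add: sum_distrib_left)
  moreover have "{..q} = insert 0 (insert q {1..<q})" using q1 by auto
  then have "(a + b) ^ q = b ^ q + (a ^ q +
      (\<Sum>k\<in>{1..<q}. of_nat (q choose k) * a ^ k * b ^ (q - k)))"
    using q1 by (simp add: binomial_ring)
  ultimately have "(a + b) ^ q = a ^ q + b ^ q +
      of_nat q * (\<Sum>k\<in>{1..<q}. of_nat ((q choose k) div q) * a ^ k * b ^ (q - k))"
    by (simp add: add_ac)
  then show ?thesis ..
qed

lemma sum_power_prime:
  fixes f :: "'b \<Rightarrow> 'a :: comm_ring_1"
  assumes q: "prime q"
  shows "\<exists>r. (\<Sum>i\<in>A. f i) ^ q = (\<Sum>i\<in>A. f i ^ q) + of_nat q * r"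
proof (induction A rule: infinite_finite_induct)
  case (insert x A)
  then obtain r where r: "(\<Sum>i\<in>A. f i) ^ q = (\<Sum>i\<in>A. f i ^ q) + of_nat q * r" by blast
  obtain s where "(f x + (\<Sum>i\<in>A. f i)) ^ q = f x ^ q + (\<Sum>i\<in>A. f i) ^ q + of_nat q * s"
    using add_power_prime[OF q] by blast
  with r insert.hyps have
    "(\<Sum>i\<in>insert x A. f i) ^ q = (\<Sum>i\<in>insert x A. f i ^ q) + of_nat q * (r + s)"
    by (simp add: algebra_simps)
  then show ?case by blast
qed (use prime_gt_0_nat[OF q] in \<open>auto intro!: exI[of _ 0] simp: power_0_left\<close>)

section \<open>Invariants of pairs of permutations\<close>

text \<open>In the application G consists of all pairs of permutations preserving the connection set
  on differences \<open>\<beta> w - \<alpha> v\<close>. Closure under \<open>swap\<close> reflects S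
  = -S and makes \<open>\<beta>\<close> bijective as well.\<close>

locale paired_permutations =
  fixes n :: int and G :: "((int \<Rightarrow> int) \<times> (int \<Rightarrow> int)) set"
  assumes n_pos: "0 < n"
    and bij: "(\<alpha>, \<beta>) \<in> G \<Longrightarrow> bij_betw \<alpha> {0..<n} {0..<n}"
    and swap: "(\<alpha>, \<beta>) \<in> G \<Longrightarrow> (\<beta>, \<alpha>) \<in> G"
begin

definition crossing :: "(int \<Rightarrow> 'a) \<Rightarrow> bool" where
  "crossing c \<longleftrightarrow> periodic n c \<and>
     (\<forall>(\<alpha>, \<beta>) \<in> G. \<forall>x \<in> {0..<n}. \<forall>y \<in> {0..<n}. c (\<beta> y - \<alpha> x) = c (y - x))"

definition parallel :: "(int \<Rightarrow> 'a) \<Rightarrow> bool" where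
  "parallel c \<longleftrightarrow> periodic n c \<and>
     (\<forall>(\<alpha>, \<beta>) \<in> G. \<forall>x \<in> {0..<n}. \<forall>y \<in> {0..<n}. c (\<alpha> y - \<alpha> x) = c (y - x))"

lemma crossing_periodic: "crossing c \<Longrightarrow> periodic n c"
  by (simp add: crossing_def)

lemma parallel_periodic: "parallel c \<Longrightarrow> periodic n c"
  by (simp add: parallel_def)

lemma crossing_comp: "crossing c \<Longrightarrow> crossing (\<lambda>z. h (c z))"
  unfolding crossing_def using periodic_comp by (auto simp: split_beta)

lemma parallel_comp: "parallel c \<Longrightarrow> parallel (\<lambda>z. h (c z))"
  unfolding parallel_def using periodic_comp by (auto simp: split_beta)

text \<open>Each \<open>\<alpha>\<close> is injective. The crossing analogue would force
  \<open>\<alpha>\<close> and \<open>\<beta>\<close> to agree.\<close>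

lemma parallel_delta: "parallel (\<lambda>z. n dvd z)"
  unfolding parallel_def
proof (intro conjI ballI, goal_cases)
  case 1 show ?case by (rule periodic_dvd) simp
next
  case (2 g)
  obtain \<alpha> \<beta> where g: "g = (\<alpha>, \<beta>)" by force
  have *: "n dvd b - a \<longleftrightarrow> b = a" if "a \<in> {0..<n}" "b \<in> {0..<n}" for a b
    using that by (metis cong_iff_dvd_diff cong_def atLeastLessThan_iff mod_pos_pos_trivial)
  have "n dvd \<alpha> y - \<alpha> x \<longleftrightarrow> n dvd y - x" if "x \<in> {0..<n}" "y \<in> {0..<n}" for x y
  proof -
    have "\<alpha> x \<in> {0..<n}" "\<alpha> y \<in> {0..<n}" "\<alpha> x = \<alpha> y \<longleftrightarrow> x = y"
      using bij[of \<alpha> \<beta>] 2 that by (auto simp: g bij_betw_def inj_on_def)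
    then show ?thesis using that by (auto simp: *)
  qed
  then show ?case by (simp add: g)
qed

text \<open>The intermediate point is moved by \<open>\<beta>\<close>: the step from
  \<open>\<alpha> x\<close> to \<open>\<beta> w\<close> crosses by the given pair, the step from
  \<open>\<beta> w\<close> to \<open>\<alpha> y\<close> by the swapped pair.\<close>

lemma parallel_conv_crossing:
  assumes c: "crossing c" and d: "crossing d" shows "parallel (conv n c d)"
  unfolding parallel_def
proof (intro conjI ballI, goal_cases)
  case 1 show ?case by (rule periodic_conv) (rule crossing_periodic[OF d])
next
  case (2 g)
  obtain \<alpha> \<beta> where g: "g = (\<alpha>, \<beta>)" by force
  note cd = crossing_periodic[OF c] crossing_periodic[OF d]
  have G: "(\<alpha>, \<beta>) \<in> G" "(\<beta>, \<alpha>) \<in> G" using 2 g swap by auto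
  have "conv n c d (\<alpha> y - \<alpha> x) = conv n c d (y - x)" if "x \<in> {0..<n}" "y \<in> {0..<n}" for x y
  proof -
    have "conv n c d (\<alpha> y - \<alpha> x) = (\<Sum>w\<in>{0..<n}. c (w - \<alpha> x) * d (\<alpha> y - w))"
      by (rule conv_diff_arg[OF n_pos cd])
    also have "\<dots> = (\<Sum>w\<in>{0..<n}. c (\<beta> w - \<alpha> x) * d (\<alpha> y - \<beta> w))"
      by (rule sum.reindex_bij_betw[OF bij[OF G(2)], symmetric])
    also have "\<dots> = (\<Sum>w\<in>{0..<n}. c (w - x) * d (y - w))"
      using c d G that by (intro sum.cong refl) (fastforce simp: crossing_def)
    also have "\<dots> = conv n c d (y - x)"
      by (rule conv_diff_arg[OF n_pos cd, symmetric])
    finally show ?thesis .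
  qed
  then show ?case by (simp add: g)
qed

text \<open>The intermediate point is moved by \<open>\<alpha>\<close>, so only the second step
  crosses.\<close>

lemma crossing_conv:
  assumes c: "parallel c" and d: "crossing d" shows "crossing (conv n c d)"
  unfolding crossing_def
proof (intro conjI ballI, goal_cases)
  case 1 show ?case by (rule periodic_conv) (rule crossing_periodic[OF d])
next
  case (2 g)
  obtain \<alpha> \<beta> where g: "g = (\<alpha>, \<beta>)" by force
  note cd = parallel_periodic[OF c] crossing_periodic[OF d]
  have G: "(\<alpha>, \<beta>) \<in> G" using 2 g by auto
  have "conv n c d (\<beta> y - \<alpha> x) = conv n c d (y - x)" if "x \<in> {0..<n}" "y \<in> {0..<n}" for x y
  proof -
    have "conv n c d (\<beta> y - \<alpha> x) = (\<Sum>w\<in>{0..<n}. c (w - \<alpha> x) * d (\<beta> y - w))"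
      by (rule conv_diff_arg[OF n_pos cd])
    also have "\<dots> = (\<Sum>w\<in>{0..<n}. c (\<alpha> w - \<alpha> x) * d (\<beta> y - \<alpha> w))"
      by (rule sum.reindex_bij_betw[OF bij[OF G], symmetric])
    also have "\<dots> = (\<Sum>w\<in>{0..<n}. c (w - x) * d (y - w))"
      using c d G that by (intro sum.cong refl) (fastforce simp: crossing_def parallel_def)
    also have "\<dots> = conv n c d (y - x)"
      by (rule conv_diff_arg[OF n_pos cd, symmetric])
    finally show ?thesis .
  qed
  then show ?case by (simp add: g)
qed

section \<open>Powers of crossing functions and scaling by units\<close>

lemma wrap_power_invariant:
  assumes "crossing (wrap n f)"
  shows "parallel (wrap n (f ^ (2 * k))) \<and> crossing (wrap n (f ^ Suc (2 * k)))"
proof (induction k)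
  case 0
  have "wrap n 1 = (\<lambda>z. of_bool (n dvd z))"
    by (simp add: fun_eq_iff one_pCons wrap_pCons wrap_0)
  then show ?case using assms parallel_comp[OF parallel_delta, of of_bool] by simp
next
  case (Suc k)
  have eq: "wrap n (g * h) = conv n (wrap n g) (wrap n h)" for g h
    by (rule ext) (rule wrap_mult[OF n_pos])
  have "parallel (wrap n (f * f ^ Suc (2 * k)))"
    unfolding eq using assms Suc.IH by (intro parallel_conv_crossing) auto
  then have 1: "parallel (wrap n (f ^ (2 * Suc k)))" by simp
  have "crossing (wrap n (f ^ (2 * Suc k) * f))"
    unfolding eq using assms 1 by (intro crossing_conv) auto
  with 1 show ?case by (simp add: mult.commute)
qed

text \<open>By the Frobenius congruence, the q-th power of the sum of X^s over s in T is modulo q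
  the sum of X^(q s), the indicator of q T. This power is crossing because q is odd, and z lies in q
  T iff m z lies in T, as m inverts q.\<close>

lemma crossing_scale_prime:
  assumes P: "crossing (P :: int \<Rightarrow> bool)" and q: "prime q" "odd q" and m: "[m * int q = 1] (mod n)"
  shows "crossing (\<lambda>z. P (m * z))"
proof -
  define T where "T = {s \<in> {0..<n}. P s}"
  define f where "f = (\<Sum>s\<in>T. monom (1 :: int) (nat s))"
  have uniq: "[s = z] (mod n) \<longleftrightarrow> s = z mod n" if "s \<in> T" for s z
    using that n_pos by (auto simp: T_def cong_def)
  have nat_T: "int (nat s) = s" if "s \<in> T" for s using that by (simp add: T_def)
  have fin: "finite T"
    unfolding T_def by (rule finite_subset[of _ "{0..<n}"]) auto
  have "wrap n f = (\<lambda>z. of_bool (P z))"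
  proof
    fix z
    have "wrap n f z = (\<Sum>s\<in>T. of_bool (s = z mod n))"
      unfolding f_def wrap_sum wrap_monom
      by (rule sum.cong[OF refl]) (simp add: uniq nat_T del: int_nat_eq)
    also have "\<dots> = of_bool (z mod n \<in> T)"
      using fin by (simp add: of_bool_def)
    also have "z mod n \<in> T \<longleftrightarrow> P z"
      using n_pos by (simp add: T_def periodic_mod[OF crossing_periodic[OF P]])
    finally show "wrap n f z = of_bool (P z)" .
  qed
  then have "crossing (wrap n f)" using crossing_comp[OF P, of of_bool] by simp
  moreover obtain k where "q = Suc (2 * k)" using q(2) by (auto elim: oddE)
  ultimately have "crossing (wrap n (f ^ q))" using wrap_power_invariant by blast
  \<comment> \<open>A pointwise operation keeps the function crossing; since q > 1, it recovers the
    indicator.\<close>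
  then have "crossing (\<lambda>z. wrap n (f ^ q) z mod int q = 1)"
    by (rule crossing_comp)
  moreover have "wrap n (f ^ q) z mod int q = 1 \<longleftrightarrow> P (m * z)" for z
  proof -
    obtain r where r: "f ^ q = (\<Sum>s\<in>T. monom 1 (nat s) ^ q) + of_nat q * r"
      using sum_power_prime[OF q(1)] unfolding f_def by blast
    have "[int (nat s * q) = z] (mod n) \<longleftrightarrow> s = (m * z) mod n" if "s \<in> T" for s
    proof -
      have "int (nat s * q) = s * int q" using that by (simp add: T_def)
      moreover have "[s * int q = z] (mod n) \<longleftrightarrow> [s = m * z] (mod n)"
      proof
        assume "[s * int q = z] (mod n)"
        then have "[m * (s * int q) = m * z] (mod n)" by (rule cong_scalar_left)
        moreover have "[m * (s * int q) = s] (mod n)"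
          using cong_scalar_left[OF m, of s] by (simp add: mult_ac)
        ultimately show "[s = m * z] (mod n)" by (metis cong_sym cong_trans)
      next
        assume "[s = m * z] (mod n)"
        then have "[s * int q = m * z * int q] (mod n)" by (rule cong_scalar_right)
        moreover have "[m * z * int q = z] (mod n)"
          using cong_scalar_left[OF m, of z] by (simp add: mult_ac)
        ultimately show "[s * int q = z] (mod n)" by (metis cong_trans)
      qed
      ultimately show ?thesis by (simp only: uniq[OF that])
    qed
    then have "wrap n (f ^ q) z = (\<Sum>s\<in>T. of_bool (s = (m * z) mod n)) + int q * wrap n r z"
      unfolding r of_nat_poly wrap_add wrap_sum monom_power wrap_monom
      by (simp add: wrap_smult)
    also have "(\<Sum>s\<in>T. of_bool (s = (m * z) mod n)) = (of_bool ((m * z) mod n \<in> T) :: int)"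
      using fin by (simp add: of_bool_def)
    also have "(m * z) mod n \<in> T \<longleftrightarrow> P (m * z)"
      using n_pos by (simp add: T_def periodic_mod[OF crossing_periodic[OF P]])
    finally show ?thesis using prime_gt_1_nat[OF q(1)] by simp
  qed
  ultimately show ?thesis by simp
qed

text \<open>An inverse of m modulo n is split into primes. Each of them is invertible modulo n,
  hence odd because n is even.\<close>

lemma crossing_scale:
  assumes P: "crossing (P :: int \<Rightarrow> bool)" and n: "even n" and m: "coprime m n"
  shows "crossing (\<lambda>z. P (m * z))"
proof -
  have n1: "\<not> n dvd 1" using n by (metis dvd_trans odd_one)
  have main: "crossing P \<Longrightarrow> [m * int k = 1] (mod n) \<Longrightarrow> crossing (\<lambda>z. P (m * z))"
    for k :: nat and m and P :: "int \<Rightarrow> bool"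
  proof (induction k arbitrary: m P rule: prime_divisors_induct)
    case zero
    then show ?case using n1 by (simp add: cong_iff_dvd_diff)
  next
    case (unit k)
    then have "[m * z = z] (mod n)" for z
      using cong_scalar_right[of m 1 n z] by simp
    then have "(\<lambda>z. P (m * z)) = P"
      using periodicD[OF crossing_periodic[OF unit(2)]] by blast
    then show ?case using unit(2) by simp
  next
    case (factor q k)
    from factor.prems(2) have m: "[m * int q * int k = 1] (mod n)" "[m * int k * int q = 1] (mod n)"
      by (simp_all add: mult_ac)
    have "even (m * int k * int q) \<longleftrightarrow> even (1 :: int)"
      by (rule cong_dvd_iff[OF cong_dvd_modulus[OF m(2) n]])
    then have q: "odd q" by simp
    \<comment> \<open>As q k is inverse to m, the inverse of k is m q and that of q is m k. Scaling
      by both in turn multiplies by m (m q k), which is m modulo n.\<close>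
    have "crossing (\<lambda>z. P (m * int q * z))"
      using factor.IH[OF factor.prems(1) m(1)] .
    from crossing_scale_prime[OF this factor.hyps q m(2)]
    have "crossing (\<lambda>z. P (m * int q * (m * int k * z)))" .
    moreover have "[m * int q * (m * int k * z) = m * z] (mod n)" for z
      using cong_scalar_left[OF factor.prems(2), of "m * z"] by (simp add: mult_ac)
    then have "(\<lambda>z. P (m * int q * (m * int k * z))) = (\<lambda>z. P (m * z))"
      using periodicD[OF crossing_periodic[OF factor.prems(1)]] by blast
    ultimately show ?case by simp
  qed
  obtain x where x: "[m * x = 1] (mod n)" using cong_solve_coprime_int[OF m] by blast
  have "[m * int (nat (x mod n)) = m * x] (mod n)"
    using n_pos by (simp add: cong_scalar_left)
  with x have "[m * int (nat (x mod n)) = 1] (mod n)" by (rule cong_trans[rotated])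
  with main[OF P] show ?thesis .
qed

section \<open>Minimal crossing sets as classes of an equivalence relation\<close>

definition alike :: "int \<Rightarrow> int \<Rightarrow> bool" where
  "alike x y \<longleftrightarrow> (\<forall>P :: int \<Rightarrow> bool. crossing P \<longrightarrow> P x = P y)"

lemma alike_sym: "alike x y \<Longrightarrow> alike y x"
  and alike_trans: "alike x y \<Longrightarrow> alike y z \<Longrightarrow> alike x z"
  unfolding alike_def by blast+

lemma alike_cong: "[x = y] (mod n) \<Longrightarrow> alike x y"
  unfolding alike_def using periodicD crossing_periodic by blast

lemma alike_crossing:
  assumes c: "crossing c" and "alike x y" shows "c x = c y"
proof -
  have "crossing (\<lambda>z. c z = c x)" using c by (rule crossing_comp)
  with assms(2) show ?thesis by (auto simp: alike_def)
qed

text \<open>The crossing condition only equates values at congruent points and at the points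
  \<open>\<beta> y - \<alpha> x\<close> and \<open>y - x\<close>, all of which are alike. So every
  union of classes is crossing.\<close>

lemma crossing_if_alike_invariant:
  assumes "\<And>x y. alike x y \<Longrightarrow> c x = c y"
  shows "crossing c"
  unfolding crossing_def
proof (intro conjI ballI, goal_cases)
  case 1 show ?case unfolding periodic_def using assms alike_cong by blast
next
  case (2 g)
  then have "alike (snd g y - fst g x) (y - x)" if "x \<in> {0..<n}" "y \<in> {0..<n}" for x y
    using that unfolding alike_def crossing_def by (auto simp: split_beta)
  then show ?case using assms by (auto simp: split_beta)
qed

lemma crossing_alike: "crossing (alike x)"
  by (rule crossing_if_alike_invariant) (metis alike_sym alike_trans)

lemma alike_scale:
  assumes "even n" "coprime m n" "alike x y" shows "alike (m * x) (m * y)"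
  using crossing_scale[OF _ assms(1,2)] assms(3) unfolding alike_def by blast

end

text \<open>C stands for the connection set. For graphs, \<open>C_even\<close> comes from
  nonbipartiteness, \<open>C_odd\<close> from connectedness and \<open>nontrivial\<close> from
  instability.\<close>

locale paired_permutations_2p = paired_permutations "2 * p" G for p G +
  fixes C :: "int \<Rightarrow> bool"
  assumes p_prime: "prime p" and p_odd: "odd p"
    and crossing_C: "crossing C"
    and not_C_0: "\<not> C 0"
    and C_even: "\<exists>z. even z \<and> C z"
    and C_odd: "\<exists>z. odd z \<and> C z"
    and nontrivial: "\<not> crossing (\<lambda>z. 2 * p dvd z)"
begin

section \<open>Arithmetic modulo 2p and the orbits of its units\<close>

lemma p_ge_3: "3 \<le> p"
  using prime_ge_2_int[OF p_prime] p_odd by (cases "p = 2") auto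

lemma dvd_2p_iff: "2 * p dvd z \<longleftrightarrow> even z \<and> p dvd z"
  using p_odd by (metis coprime_left_2_iff_odd divides_mult dvd_mult_left dvd_mult_right)

lemma cong_2p_iff: "[x = y] (mod (2 * p)) \<longleftrightarrow> (even x \<longleftrightarrow> even y) \<and> [x = y] (mod p)"
  by (simp add: cong_iff_dvd_diff dvd_2p_iff)

lemma coprime_2p_iff: "coprime m (2 * p) \<longleftrightarrow> odd m \<and> \<not> p dvd m"
proof -
  have "coprime p m \<longleftrightarrow> \<not> p dvd m"
    using p_prime by (metis coprime_absorb_left not_prime_unit prime_imp_coprime)
  then show ?thesis
    by (simp add: coprime_mult_right_iff coprime_commute coprime_right_2_iff_odd)
qed

text \<open>The quotient y / x modulo p, made odd by adding p if necessary, is a unit modulo 2p. The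
  unit orbits are thus {0}, {p}, and the even and the odd residues prime to p.\<close>

lemma unit_transitive:
  assumes xy: "even x \<longleftrightarrow> even y" "\<not> p dvd x" "\<not> p dvd y"
  shows "\<exists>m. coprime m (2 * p) \<and> [m * x = y] (mod (2 * p))"
proof -
  have "coprime x p" using xy(2) p_prime by (metis coprime_commute prime_imp_coprime)
  then obtain u where u: "[x * u = 1] (mod p)" using cong_solve_coprime_int by blast
  define m where "m = (if odd (y * u) then y * u else y * u + p)"
  have "odd m" using p_odd by (simp add: m_def)
  have "[m = y * u] (mod p)" by (simp add: m_def cong_iff_dvd_diff)
  then have "[m * x = y * u * x] (mod p)" by (rule cong_scalar_right)
  moreover have "[y * u * x = y] (mod p)" using cong_scalar_left[OF u, of y] by (simp add: mult_ac)
  ultimately have mx: "[m * x = y] (mod p)" by (rule cong_trans)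
  then have "\<not> p dvd m" using xy(3) by (metis cong_dvd_iff dvd_mult2)
  then have "coprime m (2 * p)" using \<open>odd m\<close> unfolding coprime_2p_iff by simp
  moreover have "[m * x = y] (mod (2 * p))"
    using \<open>odd m\<close> xy(1) mx unfolding cong_2p_iff by simp
  ultimately show ?thesis by blast
qed

lemma scale: "coprime m (2 * p) \<Longrightarrow> alike x y \<Longrightarrow> alike (m * x) (m * y)"
  by (rule alike_scale) simp_all

lemma scale_0: "coprime m (2 * p) \<Longrightarrow> alike 0 y \<Longrightarrow> alike 0 (m * y)"
  using scale[of m 0 y] by simp

lemma cong_p_iff: "[z = p] (mod (2 * p)) \<longleftrightarrow> odd z \<and> p dvd z"
  unfolding cong_2p_iff using p_odd by (simp add: cong_def mod_eq_0_iff_dvd)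

section \<open>Convolution of subgroup indicators in Z_2p\<close>

abbreviation "ev \<equiv> \<lambda>z. of_bool (even (z :: int)) :: int"
abbreviation "mp \<equiv> \<lambda>z. of_bool (p dvd z) :: int"
abbreviation "dl \<equiv> \<lambda>z. of_bool (2 * p dvd z) :: int"

lemma periodic_indicators: "periodic (2 * p) ev" "periodic (2 * p) mp" "periodic (2 * p) dl"
  by (intro periodic_comp[of _ _ of_bool] periodic_dvd; simp)+

lemma sum_ev: "(\<Sum>x\<in>{0..<2 * p}. ev x) = p"
proof -
  have "(\<Sum>x\<in>{0..<2 * p}. ev x) + (\<Sum>x\<in>{0..<2 * p}. ev (1 * x + 1)) = (\<Sum>x\<in>{0..<2 * p}. 1)"
    unfolding sum.distrib[symmetric] by (rule sum.cong) auto
  moreover have "(\<Sum>x\<in>{0..<2 * p}. ev (1 * x + 1)) = (\<Sum>x\<in>{0..<2 * p}. ev x)"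
    by (rule sum_periodic_affine) (use n_pos periodic_indicators in auto)
  ultimately show ?thesis using n_pos by simp
qed

lemma sum_mp: "(\<Sum>x\<in>{0..<2 * p}. mp x * f x) = f 0 + f p"
proof -
  have "x \<in> {0, p}" if "x \<in> {0..<2 * p}" "p dvd x" for x
  proof -
    obtain k where k: "x = p * k" using \<open>p dvd x\<close> by (elim dvdE)
    then have "0 \<le> k" "k < 2" using that p_ge_3 by (auto simp: zero_le_mult_iff)
    then show ?thesis using k by auto
  qed
  then have "(\<Sum>x\<in>{0..<2 * p}. mp x * f x) = (\<Sum>x\<in>{0, p}. mp x * f x)"
    using p_ge_3 by (intro sum.mono_neutral_right) fastforce+
  then show ?thesis using p_ge_3 by simp
qed

lemma conv_mp:
  assumes "periodic (2 * p) c" shows "conv (2 * p) mp c z = c z + c (z + p)"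
proof -
  have "c (z - p) = c (z + p)" by (rule periodicD[OF assms]) (simp add: cong_iff_dvd_diff)
  then show ?thesis by (simp add: conv_def sum_mp)
qed

lemma conv_one:
  assumes "periodic (2 * p) c" shows "conv (2 * p) (\<lambda>_. 1) c z = (\<Sum>x\<in>{0..<2 * p}. c x)"
  using sum_periodic_affine[OF n_pos _ assms, of "- 1" z] by (simp add: conv_def)

lemma conv_ev_ev: "conv (2 * p) ev ev z = p * ev z"
proof -
  have "conv (2 * p) ev ev z = (\<Sum>x\<in>{0..<2 * p}. ev z * ev x)"
    unfolding conv_def by (rule sum.cong) auto
  then show ?thesis by (simp add: sum_ev flip: sum_distrib_left)
qed

text \<open>For subgroups H and K, the product of the indicators is the order of their intersection
  times the indicator of H + K. The constant 1 with \<open>ev\<close>, \<open>mp\<close> and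
  \<open>dl\<close> spans the functions constant on unit orbits, so convolving these becomes linear
  algebra.\<close>

lemma conv_table:
  "conv (2 * p) (\<lambda>_. 1) (\<lambda>_. 1) z = 2 * p"
  "conv (2 * p) (\<lambda>_. 1) ev z = p" "conv (2 * p) ev (\<lambda>_. 1) z = p"
  "conv (2 * p) (\<lambda>_. 1) mp z = 2" "conv (2 * p) mp (\<lambda>_. 1) z = 2"
  "conv (2 * p) ev mp z = 1" "conv (2 * p) mp ev z = 1"
  "conv (2 * p) mp mp z = 2 * mp z"
proof -
  note pi = periodic_indicators
  have p1: "periodic (2 * p) (\<lambda>_. 1 :: int)" by (simp add: periodic_def)
  show "conv (2 * p) (\<lambda>_. 1) (\<lambda>_. 1) z = 2 * p" using n_pos by (simp add: conv_def)
  show 1: "conv (2 * p) (\<lambda>_. 1) ev z = p" using pi by (simp add: conv_one sum_ev)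
  show "conv (2 * p) ev (\<lambda>_. 1) z = p" unfolding conv_commute[OF n_pos pi(1) p1] by (rule 1)
  show 2: "conv (2 * p) mp (\<lambda>_. 1) z = 2" using p1 by (simp add: conv_mp)
  show "conv (2 * p) (\<lambda>_. 1) mp z = 2" unfolding conv_commute[OF n_pos p1 pi(2)] by (rule 2)
  show 3: "conv (2 * p) mp ev z = 1" using pi p_odd by (simp add: conv_mp)
  show "conv (2 * p) ev mp z = 1" unfolding conv_commute[OF n_pos pi(1,2)] by (rule 3)
  show "conv (2 * p) mp mp z = 2 * mp z" using pi by (simp add: conv_mp)
qed

lemma conv_dl:
  assumes "periodic (2 * p) c"
  shows "conv (2 * p) dl c z = c z" "conv (2 * p) c dl z = c z"
  using conv_delta[OF n_pos] conv_commute[OF n_pos assms periodic_indicators(3)] by simp_all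

section \<open>The class of 0\<close>

lemma alike_0_multiple:
  assumes "p dvd z" shows "alike 0 z \<longleftrightarrow> even z \<or> alike 0 p"
proof (cases "even z")
  case True
  then have "[0 = z] (mod (2 * p))"
    using assms by (intro cong_sym[of z 0]) (simp add: cong_0_iff dvd_2p_iff)
  then show ?thesis using True alike_cong by simp
next
  case False
  then have "[z = p] (mod (2 * p))" using assms cong_p_iff by simp
  from alike_cong[OF this] show ?thesis using False alike_sym alike_trans by blast
qed

text \<open>Units carry z to every even residue prime to p, so an even element of C would be alike
  to 0, which is not in C.\<close>

lemma not_alike_0_even:
  assumes "even z" "\<not> p dvd z" shows "\<not> alike 0 z"
proof
  assume z: "alike 0 z"
  obtain s where s: "even s" "C s" using C_even by blast
  have "\<not> p dvd s"
  proof
    assume "p dvd s"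
    then have "[s = 0] (mod (2 * p))" using s by (simp add: cong_0_iff dvd_2p_iff)
    then show False using s not_C_0 periodicD[OF crossing_periodic[OF crossing_C]] by blast
  qed
  then obtain m where m: "coprime m (2 * p)" "[m * z = s] (mod (2 * p))"
    using unit_transitive[of z s] assms s by blast
  have "alike 0 s" using scale_0[OF m(1) z] alike_cong[OF m(2)] by (rule alike_trans)
  then show False using alike_crossing[OF crossing_C] s not_C_0 by blast
qed

text \<open>Otherwise the class of 0 would consist of 0 and all odd residues prime to p; with p it
  would meet C. Its convolution square detects parity, so parity is parallel, and convolving parity
  with the class gives a crossing function that separates 0 from z.\<close>

lemma not_alike_0_odd:
  assumes z: "odd z" "\<not> p dvd z" shows "\<not> alike 0 z"
proof
  assume 0: "alike 0 z"
  have D: "alike 0 y" if y: "odd y" "\<not> p dvd y" for y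
  proof -
    obtain m where m: "coprime m (2 * p)" "[m * z = y] (mod (2 * p))"
      using unit_transitive[of z y] z y by blast
    show ?thesis using scale_0[OF m(1) 0] alike_cong[OF m(2)] by (rule alike_trans)
  qed
  have "\<not> alike 0 p"
  proof
    assume p: "alike 0 p"
    obtain s where s: "odd s" "C s" using C_odd by blast
    have "alike 0 s"
      using D alike_0_multiple p s by blast
    then show False using alike_crossing[OF crossing_C] s not_C_0 by blast
  qed
  then have class0: "alike 0 y \<longleftrightarrow> 2 * p dvd y \<or> odd y \<and> \<not> p dvd y" for y
    using D alike_0_multiple not_alike_0_even unfolding dvd_2p_iff by blast
  define c where "c = (\<lambda>z. 1 - ev z - mp z + 2 * dl z)"
  have "c = (\<lambda>z. of_bool (alike 0 z))"
    by (auto simp: c_def class0 dvd_2p_iff fun_eq_iff)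
  then have c: "crossing c" using crossing_comp[OF crossing_alike, of of_bool] by simp
  have "periodic (2 * p) (\<lambda>_. 1 :: int)" by (simp add: periodic_def)
  note conv_simps = conv_linear conv_table conv_ev_ev conv_dl[OF this] periodic_indicators[THEN conv_dl(1)]
    periodic_indicators[THEN conv_dl(2)]
  have "conv (2 * p) c c z = (p - 4) * ev z - 2 * mp z + 4 * dl z + 2" for z
    unfolding c_def conv_simps by (simp add: algebra_simps)
  \<comment> \<open>The values are p at 0, p - 2 at the other even residues, 0 at p and 2 at the
    other odd residues. As p is odd, these tell even from odd arguments.\<close>
  then have "even z \<longleftrightarrow> conv (2 * p) c c z \<in> {p, p - 2}" for z
    using p_ge_3 p_odd by (auto simp: dvd_2p_iff)
  then have "parallel even"
    using parallel_comp[OF parallel_conv_crossing[OF c c], of "\<lambda>v. v \<in> {p, p - 2}"] by simp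
  then have "crossing (conv (2 * p) ev c)"
    using crossing_conv[OF parallel_comp[of even of_bool] c] by simp
  from alike_crossing[OF this 0] have "conv (2 * p) ev c 0 = conv (2 * p) ev c z" .
  moreover have "conv (2 * p) ev c z = (p - 1) - (p - 2) * ev z" for z
    unfolding c_def conv_simps by (simp add: algebra_simps)
  ultimately show False using z p_ge_3 by simp
qed

lemma alike_0_iff: "alike 0 z \<longleftrightarrow> p dvd z"
proof -
  have dvd: "p dvd z" if "alike 0 z" for z
    using that not_alike_0_even not_alike_0_odd by blast
  have "alike 0 p"
  proof (rule ccontr)
    assume "\<not> alike 0 p"
    then have "alike 0 z \<longleftrightarrow> 2 * p dvd z" for z
      using alike_0_multiple dvd unfolding dvd_2p_iff by blast
    then have "alike 0 = (\<lambda>z. 2 * p dvd z)" by blast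
    with crossing_alike[of 0] nontrivial show False by simp
  qed
  then show ?thesis
    using alike_0_multiple dvd by blast
qed

section \<open>The affine symmetry z -> d z + p of the classes\<close>

lemma crossing_fold:
  assumes c: "crossing (c :: int \<Rightarrow> int)" shows "crossing (\<lambda>z. c z + c (z + p))"
proof -
  have "alike 0 = (\<lambda>z. p dvd z)" using alike_0_iff by blast
  then have mp: "crossing mp" using crossing_comp[OF crossing_alike[of 0], of of_bool] by simp
  note per = crossing_periodic[OF c]
  have "conv (2 * p) mp c = (\<lambda>z. c z + c (z + p))" using conv_mp[OF per] by blast
  then have par: "parallel (\<lambda>z. c z + c (z + p))" using parallel_conv_crossing[OF mp c] by simp
  \<comment> \<open>Convolving with \<open>mp\<close> once more turns the parallel sum into a
    crossing one. The sum is invariant under adding p, so this merely doubles it.\<close>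
  have "conv (2 * p) (\<lambda>z. c z + c (z + p)) mp z = 2 * (c z + c (z + p))" for z
  proof -
    have "c (z + p + p) = c z" by (rule periodicD[OF per]) (simp add: cong_iff_dvd_diff)
    then show ?thesis
      using conv_commute[OF n_pos parallel_periodic[OF par] periodic_indicators(2)]
        conv_mp[OF parallel_periodic[OF par]] by simp
  qed
  then have "crossing (\<lambda>z. 2 * (c z + c (z + p)))"
    using crossing_conv[OF par mp] by presburger
  from crossing_comp[OF this, of "\<lambda>v. v div 2"] show ?thesis by simp
qed

text \<open>If no class outside {0, p} mixed parities, the even residues prime to p would form a
  crossing set. Its convolution square vanishes exactly at odd arguments, so parity is parallel, and
  convolving parity with the set gives a multiple of \<open>ev\<close>, which separates 0 from p
  although they are alike.\<close>

lemma ex_alike_even_odd: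
  "\<exists>x y. even x \<and> \<not> p dvd x \<and> odd y \<and> \<not> p dvd y \<and> alike x y"
proof (rule ccontr)
  assume neg: "\<not> ?thesis"
  have "crossing (\<lambda>z. even z \<and> \<not> p dvd z)"
  proof (rule crossing_if_alike_invariant)
    fix x y assume xy: "alike x y"
    then have "p dvd x \<longleftrightarrow> p dvd y"
      unfolding alike_0_iff[symmetric] using alike_sym alike_trans by blast
    then show "(even x \<and> \<not> p dvd x) = (even y \<and> \<not> p dvd y)"
      using neg xy alike_sym[OF xy] by auto
  qed
  then have "crossing (\<lambda>z. of_bool (even z \<and> \<not> p dvd z) :: int)" by (rule crossing_comp)
  moreover define c where "c = (\<lambda>z. ev z - dl z)"
  moreover have "c = (\<lambda>z. of_bool (even z \<and> \<not> p dvd z))"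
    by (auto simp: c_def dvd_2p_iff fun_eq_iff)
  ultimately have c: "crossing c" by simp
  note conv_simps = conv_linear conv_ev_ev periodic_indicators[THEN conv_dl(1)]
    periodic_indicators[THEN conv_dl(2)]
  have "conv (2 * p) c c z = (p - 2) * ev z + dl z" for z
    unfolding c_def conv_simps by (simp add: algebra_simps)
  then have "even z \<longleftrightarrow> conv (2 * p) c c z \<noteq> 0" for z
    using p_ge_3 by (auto simp: dvd_2p_iff)
  then have "parallel even"
    using parallel_comp[OF parallel_conv_crossing[OF c c], of "\<lambda>v. v \<noteq> 0"] by simp
  then have "crossing (conv (2 * p) ev c)"
    using crossing_conv[OF parallel_comp[of even of_bool] c] by simp
  moreover have "alike 0 p" by (simp add: alike_0_iff)
  ultimately have "conv (2 * p) ev c 0 = conv (2 * p) ev c p" by (rule alike_crossing)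
  moreover have "conv (2 * p) ev c z = (p - 1) * ev z" for z
    unfolding c_def conv_simps by (simp add: algebra_simps)
  ultimately show False using p_odd p_ge_3 by simp
qed

text \<open>The unit d is chosen so that d x0 + p is the odd residue y0, alike to the even x0.
  Scaling spreads this to all even residues prime to p; the odd ones follow from comparing d^2 x
  with x.\<close>

lemma ex_unit_shift: "\<exists>d. coprime d (2 * p) \<and> (\<forall>z. C (d * z + p) = C z)"
proof -
  obtain x0 y0 where x0: "even x0" "\<not> p dvd x0" and y0: "odd y0" "\<not> p dvd y0" and xy: "alike x0 y0"
    using ex_alike_even_odd by blast
  obtain d where d: "coprime d (2 * p)" "[d * x0 = y0 + p] (mod (2 * p))"
    using unit_transitive[of x0 "y0 + p"] x0 y0 p_odd by auto
  have pp: "[z + p + p = z] (mod (2 * p))" for z by (simp add: cong_iff_dvd_diff)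
  have odd_p: "[m * p = p] (mod (2 * p))" if "odd m" for m
    using that p_odd by (simp add: cong_p_iff)
  have dp: "odd d" "\<not> p dvd d" using d(1) unfolding coprime_2p_iff by auto
  have "[d * x0 + p = y0] (mod (2 * p))"
    using cong_trans[OF cong_add[OF d(2) cong_refl[of p]] pp] .
  then have dx0: "alike (d * x0 + p) x0" using xy alike_cong alike_sym alike_trans by blast
  have even_shift: "alike (d * x + p) x" if x: "even x" "\<not> p dvd x" for x
  proof -
    obtain m where m: "coprime m (2 * p)" "[m * x0 = x] (mod (2 * p))"
      using unit_transitive[of x0 x] x0 x by blast
    have "[m * (d * x0 + p) = d * x + p] (mod (2 * p))"
      using cong_add[OF cong_scalar_left[OF m(2), of d] odd_p[of m]] m(1)
      unfolding coprime_2p_iff by (simp add: algebra_simps)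
    then show ?thesis
      using scale[OF m(1) dx0] alike_cong[OF m(2)] alike_cong alike_sym alike_trans by blast
  qed
  \<comment> \<open>If d x is not in the class of x, exactly one of d x and d x + p lies in that
    class. Folding by p gives the same count for d^2 x + p and d^2 x; the former is alike to d x, so
    the latter lies in the class.\<close>
  have double: "alike (d * (d * x)) x" if x: "even x" "\<not> p dvd x" for x
  proof (cases "alike (d * x) x")
    case True
    then show ?thesis using scale[OF d(1) True] alike_trans by blast
  next
    case False
    have dx: "even (d * x)" "\<not> p dvd d * x"
      using x dp p_prime by (simp_all add: prime_dvd_mult_iff)
    define c where "c = (\<lambda>z. of_bool (alike x z) :: int)"
    have "crossing c" unfolding c_def by (intro crossing_comp[of _ of_bool] crossing_alike)
    then have "crossing (\<lambda>z. c z + c (z + p))" by (rule crossing_fold)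
    from alike_crossing[OF this even_shift[OF dx]]
    have "c (d * (d * x) + p) + c (d * (d * x) + p + p) = c (d * x) + c (d * x + p)" .
    moreover have "c (d * x) = 0" "c (d * x + p) = 1"
      using False even_shift[OF x] by (auto simp: c_def dest: alike_sym)
    moreover have "c (d * (d * x) + p) = 0"
    proof -
      have "\<not> alike x (d * (d * x) + p)"
        using even_shift[OF dx] False alike_sym alike_trans by blast
      then show ?thesis by (simp add: c_def)
    qed
    moreover have "c (d * (d * x) + p + p) = c (d * (d * x))"
      using periodicD[OF crossing_periodic[OF \<open>crossing c\<close>] pp] .
    ultimately have "alike x (d * (d * x))" by (simp add: c_def)
    then show ?thesis by (rule alike_sym)
  qed
  have "alike (d * z + p) z" for z
  proof (cases "p dvd z")
    case True
    then have "alike 0 (d * z + p)" "alike 0 z" by (simp_all add: alike_0_iff)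
    then show ?thesis using alike_sym alike_trans by blast
  next
    case z: False
    show ?thesis
    proof (cases "even z")
      case True
      with z show ?thesis by (rule even_shift[rotated])
    next
      case False
      have "even (z + p)" "\<not> p dvd z + p" using False p_odd z by simp_all
      moreover have "even (d * x0)" "\<not> p dvd d * x0"
        using x0 dp p_prime by (simp_all add: prime_dvd_mult_iff)
      \<comment> \<open>The choice of m makes x = m x0 an even residue with d x + p = z modulo 2p.
        Then d z + p is d^2 x modulo 2p, since d p + p vanishes for odd d.\<close>
      ultimately obtain m where m: "coprime m (2 * p)" "[m * (d * x0) = z + p] (mod (2 * p))"
        using unit_transitive[of "d * x0" "z + p"] by auto
      define x where "x = m * x0"
      have x: "even x" "\<not> p dvd x"
        using x0 m(1) p_prime unfolding coprime_2p_iff by (simp_all add: x_def prime_dvd_mult_iff)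
      have "[m * (d * x0) + p = z] (mod (2 * p))"
        using cong_trans[OF cong_add[OF m(2) cong_refl[of p]] pp] .
      then have xz: "[d * x + p = z] (mod (2 * p))" by (simp add: x_def mult_ac)
      then have "alike x z" using even_shift[OF x] alike_cong alike_sym alike_trans by blast
      moreover have "[d * z + p = d * (d * x)] (mod (2 * p))"
      proof -
        have "[d * z + p = d * (d * x + p) + p] (mod (2 * p))"
          using cong_sym[OF xz] by (intro cong_add cong_scalar_left cong_refl)
        moreover have "[d * (d * x) + (d * p + p) = d * (d * x) + (p + p)] (mod (2 * p))"
          by (intro cong_add cong_refl odd_p dp)
        ultimately have "[d * z + p = d * (d * x) + (p + p)] (mod (2 * p))"
          by (simp add: algebra_simps cong_trans)
        moreover have "[d * (d * x) + (p + p) = d * (d * x)] (mod (2 * p))"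
          by (simp add: cong_iff_dvd_diff)
        ultimately show ?thesis by (rule cong_trans)
      qed
      ultimately show ?thesis using double[OF x] alike_cong alike_trans by blast
    qed
  qed
  then show ?thesis using d(1) alike_crossing[OF crossing_C] by blast
qed

end

section \<open>Two-fold automorphisms of unstable graphs\<close>

lemma connected_invariant:
  assumes X: "pair_graph X" and con: "Digraph_Component.connected (with_proj X)"
    and step: "\<And>v w. (v, w) \<in> parcs X \<Longrightarrow> Q v \<Longrightarrow> Q w"
    and u: "u \<in> pverts X" "Q u" and w: "w \<in> pverts X"
  shows "Q w"
proof -
  interpret pair_graph X by fact
  have "u \<rightarrow>\<^sup>*\<^bsub>with_proj (mk_symmetric (with_proj X))\<^esub> w"
    using con u(1) w by (auto simp: connected_def strongly_connected_def)
  then have "u \<rightarrow>\<^sup>*\<^bsub>with_proj X\<^esub> w"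
    using reachable_mk_symmetric_eq[OF sym_arcs] by simp
  then show ?thesis
  proof (induction rule: reachable_induct)
    case base
    show ?case by (rule u(2))
  next
    case (step x y)
    then show ?case using assms(3)[of x y] by (simp add: arcs_ends_def arc_to_ends_def)
  qed
qed

text \<open>As X is connected and nonbipartite, an automorphism of the double cover preserves or
  exchanges the two layers. Its actions on them are \<open>\<alpha>\<close> and
  \<open>\<beta>\<close>; if these agreed, it would come from Aut X and S_2.\<close>

lemma unstable_two_fold:
  assumes X: "pair_graph X" and con: "Digraph_Component.connected (with_proj X)"
    and nonbip: "\<not> bipartite X" and "unstable X"
  shows "\<exists>\<alpha> \<beta>. bij_betw \<alpha> (pverts X) (pverts X) \<and> bij_betw \<beta> (pverts X) (pverts X) \<and>
    (\<forall>v \<in> pverts X. \<forall>w \<in> pverts X. (\<alpha> v, \<beta> w) \<in> parcs X \<longleftrightarrow> (v, w) \<in> parcs X) \<and>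
    (\<exists>v \<in> pverts X. \<alpha> v \<noteq> \<beta> v)"
proof -
  interpret pair_graph X by fact
  let ?V = "pverts X"
  have sy: "(u, v) \<in> parcs X \<longleftrightarrow> (v, u) \<in> parcs X" for u v
    using pair_sym_arcs by (auto simp: symmetric_def dest: symD)
  have arc: "((v, i), (w, j)) \<in> parcs (bipartite_double_cover X) \<longleftrightarrow>
      (v, w) \<in> parcs X \<and> (i = 0 \<and> j = 1 \<or> i = 1 \<and> j = 0)" for v w i j
    using sy by (auto simp: bipartite_double_cover_def)
  have V2: "pverts (bipartite_double_cover X) = ?V \<times> {0, 1}"
    by (simp add: bipartite_double_cover_def)
  obtain f where f: "f \<in> automorphisms (bipartite_double_cover X)"
    and unexp: "f \<notin> expected_automorphisms X"
    using \<open>unstable X\<close> expected_automorphisms_subset[OF X] unfolding unstable_def by blast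
  have ext: "f \<in> extensional (?V \<times> {0, 1})" and bij: "bij_betw f (?V \<times> {0, 1}) (?V \<times> {0, 1})"
    using f unfolding automorphisms_def Bij_def V2 by auto
  have farc: "(f x, f y) \<in> parcs (bipartite_double_cover X) \<longleftrightarrow>
      (x, y) \<in> parcs (bipartite_double_cover X)"
    if "x \<in> ?V \<times> {0, 1}" "y \<in> ?V \<times> {0, 1}" for x y
    using f that unfolding automorphisms_def V2 by blast
  define \<alpha> a \<beta> b where "\<alpha> v = fst (f (v, 0))" and "a v = snd (f (v, 0))"
    and "\<beta> v = fst (f (v, 1))" and "b v = snd (f (v, 1))" for v
  have f0: "f (v, 0) = (\<alpha> v, a v)" and f1: "f (v, 1) = (\<beta> v, b v)" for v
    by (simp_all add: \<alpha>_def a_def \<beta>_def b_def)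
  have rng: "\<alpha> v \<in> ?V" "a v \<in> {0, 1}" "\<beta> v \<in> ?V" "b v \<in> {0, 1}" if "v \<in> ?V" for v
    using bij_betw_apply[OF bij, of "(v, 0)"] bij_betw_apply[OF bij, of "(v, 1)"] that
    by (simp_all only: f0 f1 mem_Sigma_iff) auto
  have cross: "(\<alpha> v, \<beta> w) \<in> parcs X \<and> (a v = 0 \<and> b w = 1 \<or> a v = 1 \<and> b w = 0) \<longleftrightarrow>
      (v, w) \<in> parcs X" if "v \<in> ?V" "w \<in> ?V" for v w
    using farc[of "(v, 0)" "(w, 1)"] that unfolding f0 f1 arc by auto
  have V: "v \<in> ?V" "w \<in> ?V" if "(v, w) \<in> parcs X" for v w
    using that by (auto dest: in_arcsD1 in_arcsD2)
  have ab: "a v \<noteq> b w" "a w \<noteq> b v" if "(v, w) \<in> parcs X" for v w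
    using cross[of v w] cross[of w v] V[OF that] that sy by auto
  \<comment> \<open>If both copies of every vertex landed in the same layer, that layer would
    2-colour X properly.\<close>
  have "\<exists>u \<in> ?V. a u \<noteq> b u"
  proof (rule ccontr)
    assume "\<not> ?thesis"
    then have eq: "a v = b v" if "v \<in> ?V" for v using that by blast
    have "bipartite X"
      unfolding bipartite_def
    proof (intro exI conjI)
      show "{v \<in> ?V. a v = 0} \<union> {v \<in> ?V. a v \<noteq> 0} = ?V"
        "{v \<in> ?V. a v = 0} \<inter> {v \<in> ?V. a v \<noteq> 0} = {}" by auto
      have "a v = 0 \<longleftrightarrow> a w \<noteq> 0" if "(v, w) \<in> parcs X" for v w
        using ab[OF that] eq V[OF that] rng(2)[of v] rng(2)[of w] by auto
      then show "\<forall>(v, w) \<in> parcs X. v \<in> {v \<in> ?V. a v = 0} \<and> w \<in> {v \<in> ?V. a v \<noteq> 0} \<or>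
          v \<in> {v \<in> ?V. a v \<noteq> 0} \<and> w \<in> {v \<in> ?V. a v = 0}"
        using V by blast
    qed
    with nonbip show False ..
  qed
  then obtain u where u: "u \<in> ?V" "a u \<noteq> b u" by blast
  \<comment> \<open>There are only two layers, so \<open>ab\<close> forces the layers at a vertex
    with distinct ones to recur at its neighbours.\<close>
  have side: "a v = a u \<and> b v = b u" if "v \<in> ?V" for v
  proof (rule connected_invariant[OF X con _ _ _ that, where Q = "\<lambda>v. a v = a u \<and> b v = b u"])
    show "a w = a u \<and> b w = b u" if "(v, w) \<in> parcs X" "a v = a u \<and> b v = b u" for v w
      using ab[OF that(1)] that(2) u rng(2,4)[OF u(1)] rng(2,4)[OF V(2)[OF that(1)]] by auto
  qed (use u in auto)
  have fin: "finite ?V" by (rule pair_finite_verts)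
  have inj: "f x = f y \<longleftrightarrow> x = y" if "x \<in> ?V \<times> {0, 1}" "y \<in> ?V \<times> {0, 1}" for x y
    using inj_on_eq_iff[OF bij_betw_imp_inj_on[OF bij] that] .
  have b\<alpha>: "bij_betw \<alpha> ?V ?V"
  proof -
    have i: "inj_on \<alpha> ?V"
    proof (rule inj_onI)
      fix v w assume "v \<in> ?V" "w \<in> ?V" "\<alpha> v = \<alpha> w"
      then show "v = w" using inj[of "(v, 0)" "(w, 0)"] side by (simp add: f0)
    qed
    have "\<alpha> ` ?V \<subseteq> ?V" using rng by auto
    with i show ?thesis using endo_inj_surj[OF fin] by (simp add: bij_betw_def)
  qed
  have b\<beta>: "bij_betw \<beta> ?V ?V"
  proof -
    have i: "inj_on \<beta> ?V"
    proof (rule inj_onI)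
      fix v w assume "v \<in> ?V" "w \<in> ?V" "\<beta> v = \<beta> w"
      then show "v = w" using inj[of "(v, 1)" "(w, 1)"] side by (simp only: f1) auto
    qed
    have "\<beta> ` ?V \<subseteq> ?V" using rng by auto
    with i show ?thesis using endo_inj_surj[OF fin] by (simp add: bij_betw_def)
  qed
  have arcs: "(\<alpha> v, \<beta> w) \<in> parcs X \<longleftrightarrow> (v, w) \<in> parcs X" if "v \<in> ?V" "w \<in> ?V" for v w
    using cross[OF that] side[OF that(1)] side[OF that(2)] u(2) rng(2,4)[OF u(1)] by auto
  have "\<exists>v \<in> ?V. \<alpha> v \<noteq> \<beta> v"
  proof (rule ccontr)
    assume "\<not> ?thesis"
    then have eq: "\<beta> v = \<alpha> v" if "v \<in> ?V" for v using that by auto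
    define \<phi> where "\<phi> = restrict \<alpha> ?V"
    define \<sigma> where "\<sigma> = restrict (\<lambda>i. if i = (0 :: nat) then a u else b u) {0, 1}"
    have \<phi>: "\<phi> \<in> automorphisms X"
      using b\<alpha> arcs eq by (simp add: automorphisms_def Bij_def \<phi>_def)
    have "\<sigma> ` {0, 1} = {0, 1}" "inj_on \<sigma> {0, 1}"
      using u(2) rng(2,4)[OF u(1)] by (auto simp: \<sigma>_def)
    then have "bij_betw \<sigma> {0, 1} {0, 1}" unfolding bij_betw_def by blast
    then have \<sigma>: "\<sigma> \<in> Bij {0, 1}" by (simp add: Bij_def \<sigma>_def)
    have "f = restrict (map_prod \<phi> \<sigma>) (?V \<times> {0, 1})"
    proof (rule extensionalityI[OF ext])
      fix x assume "x \<in> ?V \<times> {0 :: nat, 1}"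
      then obtain v i where x: "x = (v, i)" "v \<in> ?V" "i = 0 \<or> i = 1" by blast
      from x(3) show "f x = restrict (map_prod \<phi> \<sigma>) (?V \<times> {0, 1}) x"
      proof
        assume "i = 0"
        then show ?thesis using x side by (simp add: f0 \<phi>_def \<sigma>_def)
      next
        assume "i = 1"
        then show ?thesis using x side eq f1[of v] by (simp add: \<phi>_def \<sigma>_def)
      qed
    qed simp
    with \<phi> \<sigma> unexp show False unfolding expected_automorphisms_def by blast
  qed
  with b\<alpha> b\<beta> arcs show ?thesis by blast
qed

section \<open>Circulant graphs of order \<open>2p\<close>\<close>

lemma circulant_graph_verts: "pverts (circulant_graph n S) = {0..<n}"
  by (auto simp: circulant_graph_def residue_ring_def)

lemma circulant_graph_arcs:
  assumes "n > 1"
  shows "(v, w) \<in> parcs (circulant_graph n S) \<longleftrightarrow>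
    v \<in> {0..<n} \<and> w \<in> {0..<n} \<and> (w - v) mod n \<in> S"
proof -
  interpret residues n "residue_ring n"
    using assms by unfold_locales auto
  have "w \<ominus>\<^bsub>residue_ring n\<^esub> v = (w - v) mod n"
    by (simp add: a_minus_def res_neg_eq res_add_eq mod_simps)
  moreover have "carrier (residue_ring n) = {0..<n}" by (auto simp: res_carrier_eq)
  ultimately show ?thesis by (simp add: circulant_graph_def)
qed

text \<open>Otherwise parity would be a bipartition.\<close>

lemma ex_even_connection:
  assumes "n > 1" "even n" and "\<not> bipartite (circulant_graph n S)"
  shows "\<exists>z. even z \<and> z mod n \<in> S"
proof (rule ccontr)
  assume neg: "\<not> ?thesis"
  have "bipartite (circulant_graph n S)"
    unfolding bipartite_def
  proof (intro exI conjI)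
    show "{v \<in> {0..<n}. even v} \<union> {v \<in> {0..<n}. odd v} = pverts (circulant_graph n S)"
      "{v \<in> {0..<n}. even v} \<inter> {v \<in> {0..<n}. odd v} = {}"
      by (auto simp: circulant_graph_verts)
    show "\<forall>(v, w) \<in> parcs (circulant_graph n S).
        v \<in> {v \<in> {0..<n}. even v} \<and> w \<in> {v \<in> {0..<n}. odd v} \<or>
        v \<in> {v \<in> {0..<n}. odd v} \<and> w \<in> {v \<in> {0..<n}. even v}"
    proof clarify
      fix v w assume vw: "(v, w) \<in> parcs (circulant_graph n S)"
        and *: "\<not> (v \<in> {v \<in> {0..<n}. odd v} \<and> w \<in> {v \<in> {0..<n}. even v})"
      have "odd (w - v)" using vw neg circulant_graph_arcs[OF assms(1)] by blast
      with * vw show "v \<in> {v \<in> {0..<n}. even v} \<and> w \<in> {v \<in> {0..<n}. odd v}"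
        using circulant_graph_arcs[OF assms(1)] by auto
    qed
  qed
  with assms(3) show False ..
qed

text \<open>Otherwise parity would be constant along arcs, leaving 1 unreachable from 0.\<close>

lemma ex_odd_connection:
  assumes "n > 1" "pair_graph (circulant_graph n S)"
    and con: "Digraph_Component.connected (with_proj (circulant_graph n S))"
  shows "\<exists>z. odd z \<and> z mod n \<in> S"
proof (rule ccontr)
  assume neg: "\<not> ?thesis"
  have "even (1 :: int)"
  proof (rule connected_invariant[OF assms(2) con, where Q = even and u = 0])
    fix v w :: int assume "(v, w) \<in> parcs (circulant_graph n S)" "even v"
    then have "even (w - v)" using neg circulant_graph_arcs[OF assms(1)] by blast
    then show "even w" using \<open>even v\<close> by simp
  qed (use assms(1) in \<open>auto simp: circulant_graph_verts\<close>)
  then show False by simp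
qed

text \<open>An injective map of the finite set S into itself is onto. The multiplier is reduced
  modulo n to be an element of the ring.\<close>

lemma affine_coset_eq:
  assumes n: "n > 1" and S: "S \<subseteq> carrier (residue_ring n)" and d: "coprime d n"
    and aff: "\<And>z. (d * z + a) mod n \<in> S \<longleftrightarrow> z mod n \<in> S"
  shows "\<exists>m \<in> Units (residue_ring n). a <+\<^bsub>residue_ring n\<^esub> (m <#\<^bsub>residue_ring n\<^esub> S) = S"
proof -
  interpret residues n "residue_ring n"
    using n by unfold_locales auto
  have S': "S \<subseteq> {0..<n}" using S by (auto simp: res_carrier_eq)
  have "coprime (d mod n) n" using d n by simp
  moreover have "d mod n \<noteq> 0"
    using calculation n by auto
  moreover have "0 \<le> d mod n" "d mod n < n" using n by simp_all
  ultimately have unit: "d mod n \<in> Units (residue_ring n)"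
    by (simp add: res_units_eq)
  have "a <+\<^bsub>residue_ring n\<^esub> ((d mod n) <#\<^bsub>residue_ring n\<^esub> S) = (\<lambda>s. (d * s + a) mod n) ` S"
    by (auto simp: a_l_coset_def' l_coset_def res_add_eq res_mult_eq mod_simps add.commute)
  also have "\<dots> = S"
  proof (rule endo_inj_surj)
    show "finite S" using S' finite_subset by blast
    show "(\<lambda>s. (d * s + a) mod n) ` S \<subseteq> S" using aff S' by fastforce
    show "inj_on (\<lambda>s. (d * s + a) mod n) S"
      using bij_betw_affine_mod[of n d a] n d S' inj_on_subset unfolding bij_betw_def by auto
  qed
  finally show ?thesis using unit by blast
qed

theorem theorem5p1:
  fixes p :: int and S :: "int set"
  assumes "prime p"
    and "S \<subseteq> carrier (residue_ring (2 * p))"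
    and "(\<lambda>s. \<ominus>\<^bsub>residue_ring (2 * p)\<^esub> s) ` S = S"
    and "\<zero>\<^bsub>residue_ring (2 * p)\<^esub> \<notin> S"
    and "nontrivially_unstable (circulant_graph (2 * p) S)"
  shows "\<exists>m \<in> Units (residue_ring (2 * p)).
    p <+\<^bsub>residue_ring (2 * p)\<^esub> (m <#\<^bsub>residue_ring (2 * p)\<^esub> S) = S"
proof -
  have n: "2 * p > 1" using prime_gt_1_int[OF assms(1)] by simp
  interpret residues "2 * p" "residue_ring (2 * p)"
    using n by unfold_locales auto
  let ?X = "circulant_graph (2 * p) S" and ?V = "{0..<2 * p}"
  have X: "pair_graph ?X" using pair_graph_circulant_graph[OF n assms(2-4)] .
  have con: "Digraph_Component.connected (with_proj ?X)" and "\<not> bipartite ?X" "unstable ?X"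
    using assms(5) by (auto simp: nontrivially_unstable_def)
  define C where "C z \<longleftrightarrow> z mod (2 * p) \<in> S" for z
  have C0: "\<not> C 0" using assms(4) by (simp add: C_def res_zero_eq)
  have neg: "C (- z)" if "C z" for z
  proof -
    have "\<ominus>\<^bsub>residue_ring (2 * p)\<^esub> (z mod (2 * p)) \<in> S"
      using assms(3) that unfolding C_def by blast
    then show ?thesis by (simp add: C_def res_neg_eq mod_simps)
  qed
  have C_even: "\<exists>z. even z \<and> C z"
    using ex_even_connection[OF n _ \<open>\<not> bipartite ?X\<close>] by (simp add: C_def)
  have C_odd: "\<exists>z. odd z \<and> C z"
    using ex_odd_connection[OF n X con] by (simp add: C_def)
  define G where "G = {(\<alpha>, \<beta>). bij_betw \<alpha> ?V ?V \<and> bij_betw \<beta> ?V ?V \<and>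
    (\<forall>v \<in> ?V. \<forall>w \<in> ?V. C (\<beta> w - \<alpha> v) = C (w - v))}"
  have neg_iff: "C (- z) = C z" for z using neg[of z] neg[of "- z"] by auto
  have swap: "C (\<alpha> w - \<beta> v) = C (w - v)"
    if "C (\<beta> v - \<alpha> w) = C (v - w)" for \<alpha> \<beta> v w
    using that neg_iff[of "\<beta> v - \<alpha> w"] neg_iff[of "v - w"] by simp
  interpret paired_permutations "2 * p" G
  proof
    show "(\<beta>, \<alpha>) \<in> G" if "(\<alpha>, \<beta>) \<in> G" for \<alpha> \<beta>
      using that swap unfolding G_def by blast
  qed (use n in \<open>auto simp: G_def\<close>)
  have C: "crossing C"
    unfolding crossing_def periodic_def by (auto simp: G_def C_def cong_def)
  \<comment> \<open>Taking both points equal, a crossing indicator of 0 would force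
    \<open>\<beta> v = \<alpha> v\<close> for every pair in G.\<close>
  have nontrivial: "\<not> crossing (\<lambda>z. 2 * p dvd z)"
  proof
    assume triv: "crossing (\<lambda>z. 2 * p dvd z)"
    obtain \<alpha> \<beta> v where bij: "bij_betw \<alpha> ?V ?V" "bij_betw \<beta> ?V ?V"
      and arcs: "\<forall>v \<in> ?V. \<forall>w \<in> ?V. (\<alpha> v, \<beta> w) \<in> parcs ?X \<longleftrightarrow> (v, w) \<in> parcs ?X"
      and v: "v \<in> ?V" "\<alpha> v \<noteq> \<beta> v"
      using unstable_two_fold[OF X con \<open>\<not> bipartite ?X\<close> \<open>unstable ?X\<close>]
      unfolding circulant_graph_verts by blast
    have "C (\<beta> w - \<alpha> v) = C (w - v)" if "v \<in> ?V" "w \<in> ?V" for v w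
    proof -
      have "\<alpha> v \<in> ?V" "\<beta> w \<in> ?V"
        using bij_betw_apply[OF bij(1) that(1)] bij_betw_apply[OF bij(2) that(2)] .
      moreover have "(\<alpha> v, \<beta> w) \<in> parcs ?X \<longleftrightarrow> (v, w) \<in> parcs ?X"
        using arcs that by blast
      ultimately show ?thesis
        using that unfolding circulant_graph_arcs[OF n] C_def by argo
    qed
    then have "(\<alpha>, \<beta>) \<in> G" using bij by (simp add: G_def)
    with triv v(1) have "2 * p dvd \<beta> v - \<alpha> v \<longleftrightarrow> 2 * p dvd v - v"
      unfolding crossing_def by fast
    then have "[\<beta> v = \<alpha> v] (mod (2 * p))" by (simp add: cong_iff_dvd_diff)
    moreover have "\<alpha> v \<in> ?V" "\<beta> v \<in> ?V"
      using bij_betw_apply[OF bij(1) v(1)] bij_betw_apply[OF bij(2) v(1)] .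
    ultimately show False using v(2) by (simp add: cong_def)
  qed
  \<comment> \<open>For p = 2 the even element of C is 2, and by symmetry 1 and 3 both occur, so the
    graph is complete. The complement of C is then the set of multiples of 4, and its being crossing
    contradicts \<open>nontrivial\<close>.\<close>
  have "odd p"
  proof
    assume "even p"
    then have p: "p = 2" using primes_dvd_imp_eq[of 2 p] assms(1) by simp
    have mod: "C z = C (z mod 4)" for z by (simp add: C_def p)
    obtain e where "even e" "C e" using C_even by blast
    moreover have "e mod 4 \<noteq> 0" using C0 mod[of e] \<open>C e\<close> by auto
    ultimately have "e mod 4 = 2" by presburger
    then have C2: "C 2" using mod[of e] \<open>C e\<close> by simp
    obtain o' where "odd o'" "C o'" using C_odd by blast
    then have "o' mod 4 = 1 \<or> o' mod 4 = 3" by presburger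
    then have "C 1 \<or> C 3" using mod[of o'] \<open>C o'\<close> by auto
    then have C13: "C 1" "C 3" using neg[of 1] neg[of 3] mod[of "- 1"] mod[of "- 3"] by auto
    have "C z \<longleftrightarrow> \<not> 4 dvd z" for z
    proof -
      have "z mod 4 = 0 \<or> z mod 4 = 1 \<or> z mod 4 = 2 \<or> z mod 4 = 3" by presburger
      then show ?thesis using mod[of z] C0 C2 C13 by (auto simp: dvd_eq_mod_eq_0)
    qed
    then have "crossing (\<lambda>z. \<not> \<not> 2 * p dvd z)" using crossing_comp[OF C, of Not] by (simp add: p)
    with nontrivial show False by simp
  qed
  then interpret paired_permutations_2p p G C
    by unfold_locales (use assms(1) C C0 C_even C_odd nontrivial in auto)
  obtain d where "coprime d (2 * p)" "\<And>z. C (d * z + p) = C z"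
    using ex_unit_shift by blast
  then show ?thesis using affine_coset_eq[OF n assms(2)] by (simp add: C_def)
qed

end
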